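(* Let $H>0$ and $R\in(0,\pi)$. For $0\le h\le H$ and $0\le\theta_0\le R$ let $u_{h,\theta_0}$ be the rotationally symmetric function on $\Omega_R=\{\Psi(\theta,\phi):0\le\theta\le R\}$ given by $$u_{h,\theta_0}(\theta)=\begin{cases}h,&\theta\in[0,\theta_0],\\ \frac{h}{R-\theta_0}(R-\theta),&\theta\in(\theta_0,R],\end{cases}$$ (with $u_{h,R}\equiv h$), and let $g(\theta_0)=R_2[u_{H,\theta_0}]$, i.e. for $\theta_0<R$, with $K=H/(R-\theta_0)$, $$g(\theta_0)=2\pi e^{-2H}(1-\cos\theta_0)+\frac{2\pi}{1+K^2}\int_{\theta_0}^R e^{-2K(R-\theta)}\sin\theta\,d\theta .$$ Then the function $(h,\theta_0)\mapsto R_2[u_{h,\theta_0}]$ on $[0,H]\times[0,R]$ attains its minimum at a unique point $(H,\theta_0^* )$, where $\theta_0^*$ is the unique solution in $(0,R)$ of $g'(\theta_0)=0$.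
   Context: Spherical coordinates $\Psi(\theta,\phi)=(\sin\theta\cos\phi,\sin\theta\sin\phi,\cos\theta)$ on $\mathbb{S}^2$. For $u$ on a domain $\Omega\subset\mathbb{S}^2$, $R_2[u]=\int_\Omega\frac{e^{-2u}}{1+|\nabla_{\mathbb{S}^2}u|^2}d\Omega$; for rotationally symmetric $u=u(\theta)$ on $\Omega_R$ this equals $2\pi\int_0^R\frac{e^{-2u(\theta)}\sin\theta}{1+u'(\theta)^2}d\theta$. The graphs of the $u_{h,\theta_0}$ are called radial frustum cones. *)

theory Defs
  imports "HOL-Analysis.Analysis"
begin

text \<open>The functional R_2 for a rotationally symmetric u = u(theta) on the spherical cap
  Omega_R: R_2[u] = 2 pi int_0^R e^(-2u) sin theta / (1 + u'(theta)^2) d theta.\<close>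
definition R2_rot :: "real \<Rightarrow> (real \<Rightarrow> real) \<Rightarrow> real" where
  "R2_rot R u = 2 * pi * integral {0..R} (\<lambda>\<theta>. exp (-2 * u \<theta>) * sin \<theta> / (1 + (deriv u \<theta>)\<^sup>2))"

text \<open>Radial frustum cone profile u_{h,theta0} on [0,R] (for theta0 = R it is constantly h on [0,R]).\<close>
definition u_frustum :: "real \<Rightarrow> real \<Rightarrow> real \<Rightarrow> real \<Rightarrow> real" where
  "u_frustum R h \<theta>0 \<theta> = (if \<theta> \<le> \<theta>0 then h else h / (R - \<theta>0) * (R - \<theta>))"

end

(* Lowering the plateau height h strictly increases the functional, so h = H.
   Put L = R - t. Up to the factor 2 pi the value at height H is
     f L = exp (-2H) (1 - cos (R - L)) + L^3 / (L^2 + H^2) * I,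
   where I and J are the integrals of exp (-2Hx) sin (R - Lx) and x exp (-2Hx) sin (R - Lx)
   over [0,1].  An integration by parts shows that f' L has the sign of
     L^2 B - exp (-2H) H^3 sin (R - L),
   B = H * (integral of exp (-2Hx) P(Lx)) + 2 (L^2 + 2H^2) J,  P(y) = sin (R - y) + y cos (R - y).
   Here P is nonnegative and increasing since P(0) = sin R and P'(y) = y sin (R - y), and together with the log-concavity
   of sin this makes L B / sin (R - L) nondecreasing.  Hence L^2 B / sin (R - L) is strictly
   increasing, and f' changes sign exactly once, from negative to positive. *)

theory Submission
  imports Defs
begin

section \<open>Inequalities for sine on [0, pi]\<close>

lemma sin_ge_min:
  assumes "0 \<le> u" "u \<le> m" "m \<le> v" "v \<le> pi"
  shows "sin m \<ge> min (sin u) (sin v)"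
proof (cases "m \<le> pi / 2")
  case True
  then have "sin u \<le> sin m"
    using assms by (intro sin_monotone_2pi_le) auto
  then show ?thesis by simp
next
  case False
  then have "sin (pi - v) \<le> sin (pi - m)"
    using assms by (intro sin_monotone_2pi_le) auto
  then show ?thesis by simp
qed

text \<open>The expression is the height at which the tangent to \<open>sin (R - y)\<close> at the
  point y meets the vertical axis. It is also -y^2 times the derivative of
  \<open>sin (R - y) / y\<close>.\<close>

lemma sin_tangent_mono:
  fixes a b R :: real
  assumes "0 \<le> a" "a \<le> b" "b \<le> R" "R \<le> pi"
  shows "sin (R - a) + a * cos (R - a) \<le> sin (R - b) + b * cos (R - b)"
proof (rule DERIV_nonneg_imp_nondecreasing[OF assms(2)])
  fix y assume y: "a \<le> y" "y \<le> b"
  have "((\<lambda>y. sin (R - y) + y * cos (R - y)) has_field_derivative y * sin (R - y)) (at y)"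
    by (auto intro!: derivative_eq_intros)
  moreover have "y * sin (R - y) \<ge> 0"
    using y assms by (intro mult_nonneg_nonneg sin_ge_zero) auto
  ultimately show "\<exists>d. ((\<lambda>y. sin (R - y) + y * cos (R - y)) has_field_derivative d) (at y) \<and> 0 \<le> d"
    by blast
qed

lemma sin_tangent_nonneg:
  fixes y R :: real
  assumes "0 \<le> y" "y \<le> R" "R \<le> pi"
  shows "sin (R - y) + y * cos (R - y) \<ge> 0"
  using sin_tangent_mono[of 0 y R] assms sin_ge_zero[of R] by auto

lemma sin_over_arg_antimono:
  fixes a b R :: real
  assumes "0 < a" "a \<le> b" "b \<le> R" "R \<le> pi"
  shows "a * sin (R - b) \<le> b * sin (R - a)"
proof -
  have "sin (R - b) / b \<le> sin (R - a) / a"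
  proof (rule DERIV_nonpos_imp_nonincreasing[OF assms(2)])
    fix y assume y: "a \<le> y" "y \<le> b"
    have "((\<lambda>y. sin (R - y) / y) has_field_derivative - (sin (R - y) + y * cos (R - y)) / y\<^sup>2) (at y)"
      using y assms by (auto intro!: derivative_eq_intros simp: power2_eq_square algebra_simps)
    moreover have "- (sin (R - y) + y * cos (R - y)) / y\<^sup>2 \<le> 0"
      using y assms sin_tangent_nonneg[of y R] by (simp add: divide_nonpos_nonneg)
    ultimately show "\<exists>d. ((\<lambda>y. sin (R - y) / y) has_field_derivative d) (at y) \<and> d \<le> 0"
      by blast
  qed
  then show ?thesis using assms by (simp add: field_simps)
qed

text \<open>Pointwise source of the monotonicity of the sine moments relative to
  \<open>sin (R - L)\<close>, cross-multiplied so that it still makes sense at b = R. Since a x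
  \<le> b x \<le> a x + (b - a), quasi-concavity bounds \<open>sin (R - b * x)\<close> below by the
  sine at one of the two end arguments. The end R - a x is settled by
  \<open>sin_over_arg_antimono\<close>, the other end by a product identity.\<close>

lemma sin_ratio_mono:
  fixes a b x R :: real
  assumes "0 < a" "a \<le> b" "b \<le> R" "R \<le> pi" "0 \<le> x" "x \<le> 1"
  shows "a * sin (R - a * x) * sin (R - b) \<le> b * sin (R - b * x) * sin (R - a)"
proof -
  have ax: "0 \<le> a * x" "a * x \<le> a" "a * x \<le> b * x" "(b - a) * x \<le> b - a"
    using assms by (auto intro!: mult_right_mono mult_left_le)
  then have bx: "b * x \<le> a * x + (b - a)" by (simp add: algebra_simps)
  have nn: "sin (R - b) \<ge> 0" "sin (R - a) \<ge> 0" "sin (R - a * x) \<ge> 0" "sin (R - b * x) \<ge> 0"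
    by (rule sin_ge_zero; use assms ax bx in linarith)+
  have "sin (R - b * x) \<ge> min (sin (R - (a * x + (b - a)))) (sin (R - a * x))"
    by (rule sin_ge_min; use assms ax bx in linarith)
  then consider "sin (R - b * x) \<ge> sin (R - a * x)" | "sin (R - b * x) \<ge> sin (R - (a * x + (b - a)))"
    by linarith
  then show ?thesis
  proof cases
    case 1
    have "sin (R - a * x) * (a * sin (R - b)) \<le> sin (R - b * x) * (b * sin (R - a))"
      by (rule mult_mono) (use 1 sin_over_arg_antimono[OF assms(1-4)] nn assms in auto)
    then show ?thesis by (simp add: mult_ac)
  next
    case 2
    \<comment> \<open>by concavity, log sin loses less under the shift by \<open>b - a\<close> at the larger argument\<close>
    have "sin (R - (a * x + (b - a))) * sin (R - a) - sin (R - a * x) * sin (R - b)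
        = sin (b - a) * sin (a - a * x)"
    proof -
      define p q d where "p = R - a" and "q = a - a * x" and "d = b - a"
      \<comment> \<open>Keeping the factor sin^2 + cos^2 makes this a polynomial identity in the
        sines and cosines of p, q and d.\<close>
      have "sin (p + q - d) * sin p - sin (p + q) * sin (p - d) = sin d * sin q * ((sin p)\<^sup>2 + (cos p)\<^sup>2)"
        by (simp only: sin_diff cos_diff sin_add cos_add) algebra
      then show ?thesis by (simp add: p_def q_def d_def algebra_simps)
    qed
    also have "\<dots> \<ge> 0"
      by (intro mult_nonneg_nonneg sin_ge_zero; use assms ax in linarith)
    finally have "sin (R - a * x) * sin (R - b) \<le> sin (R - (a * x + (b - a))) * sin (R - a)" by simp
    also have "\<dots> \<le> sin (R - b * x) * sin (R - a)"
      using 2 nn by (intro mult_right_mono)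
    finally have "sin (R - a * x) * sin (R - b) \<le> sin (R - b * x) * sin (R - a)" .
    with \<open>a \<le> b\<close> have "a * (sin (R - a * x) * sin (R - b)) \<le> b * (sin (R - b * x) * sin (R - a))"
      by (rule mult_mono) (use assms nn in auto)
    then show ?thesis by (simp add: mult_ac)
  qed
qed

section \<open>Weighted trigonometric moments\<close>

text \<open>The variable x = (R - \<theta>) / L rescales the conical part to [0, 1], so L enters
  only through the integrand and can be differentiated under the integral sign.\<close>

definition sin_moment :: "real \<Rightarrow> (real \<Rightarrow> real) \<Rightarrow> real \<Rightarrow> real" where
  "sin_moment R w L = integral {0..1} (\<lambda>x. w x * sin (R - L * x))"

definition cos_moment :: "real \<Rightarrow> (real \<Rightarrow> real) \<Rightarrow> real \<Rightarrow> real" where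
  "cos_moment R w L = integral {0..1} (\<lambda>x. w x * cos (R - L * x))"

lemma sin_moment_has_derivative:
  assumes w: "continuous_on UNIV w"
  shows "(sin_moment R w has_field_derivative - cos_moment R (\<lambda>x. x * w x) L) (at L)"
proof -
  have w': "continuous_on S w" for S
    using w continuous_on_subset by blast
  have "((\<lambda>L. integral (cbox 0 1) (\<lambda>x. w x * sin (R - L * x))) has_field_derivative
      integral (cbox 0 1) (\<lambda>x. - (x * w x * cos (R - L * x)))) (at L within UNIV)"
  proof (rule leibniz_rule_field_derivative)
    show "((\<lambda>L. w x * sin (R - L * x)) has_field_derivative - (x * w x * cos (R - L * x)))
        (at L within UNIV)" for L x
      by (auto intro!: derivative_eq_intros)
    show "(\<lambda>x. w x * sin (R - L * x)) integrable_on cbox 0 1" for L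
      by (intro integrable_continuous continuous_intros w')
    show "continuous_on (UNIV \<times> cbox 0 1) (\<lambda>(L, x). - (x * w x * cos (R - L * x)))"
      unfolding split_beta by (intro continuous_intros continuous_on_compose2[OF w]) auto
  qed auto
  then show ?thesis
    unfolding sin_moment_def[abs_def] cos_moment_def by simp
qed

lemma continuous_on_sin_moment [continuous_intros]:
  assumes "continuous_on UNIV w"
  shows "continuous_on S (sin_moment R w)"
  by (meson DERIV_isCont continuous_at_imp_continuous_on sin_moment_has_derivative[OF assms])

text \<open>Integrates the derivative of \<open>x * w x * sin (R - L * x)\<close>, which vanishes at
  x = 0. The identity serves to eliminate the cosine moment that differentiation in L
  produces.\<close>

lemma exp_sin_moment_by_parts:
  fixes H L R :: real
  defines "w \<equiv> \<lambda>x::real. exp (- 2 * H * x)"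
  shows "exp (- 2 * H) * sin (R - L) =
    sin_moment R w L - 2 * H * sin_moment R (\<lambda>x. x * w x) L - L * cos_moment R (\<lambda>x. x * w x) L"
proof -
  have int: "(\<lambda>x. w x * sin (R - L * x)) integrable_on {0..1}"
    "(\<lambda>x. x * w x * sin (R - L * x)) integrable_on {0..1}"
    "(\<lambda>x. x * w x * cos (R - L * x)) integrable_on {0..1}"
    unfolding w_def by (intro integrable_continuous_real continuous_intros)+
  have "((\<lambda>x. w x * sin (R - L * x) - 2 * H * (x * w x * sin (R - L * x))
        - L * (x * w x * cos (R - L * x))) has_integral
      (1 * w 1 * sin (R - L * 1) - 0 * w 0 * sin (R - L * 0))) {0..1}"
    unfolding w_def
    by (rule fundamental_theorem_of_calculus)
      (auto intro!: derivative_eq_intros simp: has_real_derivative_iff_has_vector_derivative[symmetric] algebra_simps)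
  moreover have "((\<lambda>x. w x * sin (R - L * x) - 2 * H * (x * w x * sin (R - L * x))
        - L * (x * w x * cos (R - L * x))) has_integral
      (sin_moment R w L - 2 * H * sin_moment R (\<lambda>x. x * w x) L
        - L * cos_moment R (\<lambda>x. x * w x) L)) {0..1}"
    unfolding sin_moment_def cos_moment_def
    by (intro has_integral_diff has_integral_mult_right integrable_integral int)
  ultimately have "1 * w 1 * sin (R - L * 1) - 0 * w 0 * sin (R - L * 0) =
      sin_moment R w L - 2 * H * sin_moment R (\<lambda>x. x * w x) L - L * cos_moment R (\<lambda>x. x * w x) L"
    by (rule has_integral_unique)
  then show ?thesis by (simp add: w_def)
qed

text \<open>For 0 < x < 1 the argument R - L x stays strictly between 0 and pi, even when L = R.
  Positivity of the weight is asked only for x > 0, so that the weight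
  \<open>x * exp (- 2 * H * x)\<close> is covered.\<close>

lemma sin_moment_pos:
  fixes R L :: real
  assumes "continuous_on UNIV w" "\<And>x. 0 < x \<Longrightarrow> w x > 0" "0 < R" "R < pi" "0 \<le> L" "L \<le> R"
  shows "sin_moment R w L > 0"
proof -
  have "integral {0..1} (\<lambda>x::real. 0::real) < integral {0..1} (\<lambda>x. w x * sin (R - L * x))"
  proof (rule integral_less_real)
    have c: "continuous_on {0..1} w"
      using assms(1) continuous_on_subset by blast
    show "continuous_on {0..1} (\<lambda>x. w x * sin (R - L * x))"
      by (intro continuous_intros c)
    fix x :: real assume x: "x \<in> {0<..<1}"
    have "L * x \<le> R * x" "0 \<le> L * x"
      using x assms by (simp_all add: mult_right_mono)
    moreover have "R * x < R * 1"
      using x assms by (intro mult_strict_left_mono) auto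
    ultimately have "sin (R - L * x) > 0"
      using assms by (intro sin_gt_zero; linarith)
    then show "0 < w x * sin (R - L * x)"
      using x assms(2) by simp
  qed auto
  then show ?thesis by (simp add: sin_moment_def)
qed

section \<open>Closed form of the functional and its dependence on the height\<close>

text \<open>The integral splits at t into plateau and cone. The derivative of the profile is
  computed only in the two open intervals, so its value at the kink is irrelevant. In the cubed
  factor, L^2 comes from the slope -h/L and the last L from the substitution.\<close>

lemma R2_rot_u_frustum:
  fixes h t R :: real
  assumes "0 \<le> t" "t \<le> R"
  shows "R2_rot R (u_frustum R h t) = 2 * pi * (exp (- 2 * h) * (1 - cos t)
    + (R - t) ^ 3 / ((R - t)\<^sup>2 + h\<^sup>2) * sin_moment R (\<lambda>x. exp (- 2 * h * x)) (R - t))"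
proof -
  define u where "u = u_frustum R h t"
  define f where "f = (\<lambda>\<theta>. exp (-2 * u \<theta>) * sin \<theta> / (1 + (deriv u \<theta>)\<^sup>2))"
  define L where "L = R - t"
  define I where "I = sin_moment R (\<lambda>x. exp (- 2 * h * x)) L"
  have "((\<lambda>\<theta>. exp (- 2 * h) * sin \<theta>) has_integral
      (- exp (- 2 * h) * cos t - (- exp (- 2 * h) * cos 0))) {0..t}"
    by (rule fundamental_theorem_of_calculus)
      (auto intro!: derivative_eq_intros assms simp: has_real_derivative_iff_has_vector_derivative[symmetric])
  moreover have "f \<theta> = exp (- 2 * h) * sin \<theta>" if "\<theta> \<in> {0<..<t}" for \<theta>
  proof -
    have "deriv u \<theta> = 0"
    proof (rule DERIV_imp_deriv, rule has_field_derivative_transform_within_open[where S="{..<t}"])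
      show "((\<lambda>_. h) has_field_derivative 0) (at \<theta>)" by simp
    qed (use that in \<open>auto simp: u_def u_frustum_def\<close>)
    then show ?thesis using that by (simp add: f_def u_def u_frustum_def)
  qed
  ultimately have 1: "(f has_integral exp (- 2 * h) * (1 - cos t)) {0..t}"
    using has_integral_spike_interior[of _ _ 0 t f] by (simp add: algebra_simps)
  have 2: "(f has_integral L ^ 3 / (L\<^sup>2 + h\<^sup>2) * I) {t..R}"
  proof (cases "t = R")
    \<comment> \<open>Here L = 0, so the claimed value is 0, also for h = 0 because 0 / 0 =
      0.\<close>
    case True
    then show ?thesis using has_integral_refl(2)[of f R] by (simp add: L_def)
  next
    case False
    then have L: "L > 0" using assms by (simp add: L_def)
    have "((\<lambda>x. exp (- 2 * h * x) * sin (R - L * x)) has_integral I) (cbox 0 1)"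
      unfolding I_def sin_moment_def cbox_interval
      by (intro integrable_integral integrable_continuous_real continuous_intros)
    moreover have "(\<lambda>x. R - x * L) ` {0..1} = {R - L..R}"
      using image_affinity_atLeastAtMost[of "- L" R 0 1] L by (simp add: mult.commute)
    ultimately
    have "((\<lambda>\<theta>. exp (- 2 * h * ((R - \<theta>) / L)) * sin (R - L * ((R - \<theta>) / L))) has_integral L * I) {R - L..R}"
      \<comment> \<open>The affine map is x = -\<theta> / L + R / L, with Jacobian 1 / L.\<close>
      using has_integral_affinity[of _ I 0 1 "- (1 / L)" "R / L"] L
      by (fastforce simp: diff_divide_distrib mult.commute)
    then have "((\<lambda>\<theta>. exp (- 2 * h * ((R - \<theta>) / L)) * sin \<theta>) has_integral L * I) {t..R}"
      using L by (simp add: L_def)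
    then have i: "((\<lambda>\<theta>. L\<^sup>2 / (L\<^sup>2 + h\<^sup>2) * (exp (- 2 * h * ((R - \<theta>) / L)) * sin \<theta>))
        has_integral L\<^sup>2 / (L\<^sup>2 + h\<^sup>2) * (L * I)) (cbox t R)"
      unfolding cbox_interval by (rule has_integral_mult_right)
    have "f \<theta> = L\<^sup>2 / (L\<^sup>2 + h\<^sup>2) * (exp (- 2 * h * ((R - \<theta>) / L)) * sin \<theta>)"
      if "\<theta> \<in> box t R" for \<theta>
    proof -
      have "deriv u \<theta> = - (h / L)"
      proof (rule DERIV_imp_deriv, rule has_field_derivative_transform_within_open[where S="{t<..}"])
        show "((\<lambda>\<theta>. h / L * (R - \<theta>)) has_field_derivative - (h / L)) (at \<theta>)"
          using L by (auto intro!: derivative_eq_intros)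
      qed (use that in \<open>auto simp: u_def u_frustum_def L_def\<close>)
      then have "f \<theta> = 1 / (1 + (h / L)\<^sup>2) * (exp (- 2 * u \<theta>) * sin \<theta>)"
        by (simp add: f_def)
      also have "1 / (1 + (h / L)\<^sup>2) = L\<^sup>2 / (L\<^sup>2 + h\<^sup>2)"
      proof -
        have "1 + (h / L)\<^sup>2 = (L\<^sup>2 + h\<^sup>2) / L\<^sup>2"
          using L by (simp add: power_divide add_divide_distrib)
        then show ?thesis by simp
      qed
      also have "- 2 * u \<theta> = - 2 * h * ((R - \<theta>) / L)"
        using that by (simp add: u_def u_frustum_def L_def)
      finally show ?thesis .
    qed
    from has_integral_spike_interior[OF i this] show ?thesis
      by (simp add: power3_eq_cube power2_eq_square mult.assoc)
  qed
  have "integral {0..R} f = exp (- 2 * h) * (1 - cos t) + L ^ 3 / (L\<^sup>2 + h\<^sup>2) * I"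
    by (rule integral_unique[OF has_integral_combine[OF assms 1 2]])
  then show ?thesis
    by (simp add: R2_rot_def f_def u_def L_def I_def)
qed

text \<open>Both exponential weights and the coefficient
  \<open>L ^ 3 / (L\<^sup>2 + h\<^sup>2)\<close> are nonincreasing in h, against nonnegative
  sines.\<close>

lemma R2_rot_u_frustum_strict_antimono:
  fixes h H t R :: real
  assumes "0 \<le> h" "h < H" "0 \<le> t" "t \<le> R" "0 < R" "R < pi"
  shows "R2_rot R (u_frustum R H t) < R2_rot R (u_frustum R h t)"
proof -
  define L where "L = R - t"
  define I where "I = (\<lambda>h. sin_moment R (\<lambda>x. exp (- 2 * h * x)) L)"
  have L: "0 \<le> L" "L \<le> R" using assms by (auto simp: L_def)
  have Ipos: "I h > 0" for h
    unfolding I_def by (intro sin_moment_pos continuous_intros) (use assms L in auto)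
  have "I H \<le> I h"
    unfolding I_def sin_moment_def
  proof (rule integral_le)
    fix x :: real assume x: "x \<in> {0..1}"
    then have "L * x \<le> L" "0 \<le> L * x"
      using L by (simp_all add: mult_left_le)
    then have "sin (R - L * x) \<ge> 0"
      using L assms by (intro sin_ge_zero; linarith)
    then show "exp (- 2 * H * x) * sin (R - L * x) \<le> exp (- 2 * h * x) * sin (R - L * x)"
      using x assms by (intro mult_right_mono) (auto intro!: mult_right_mono)
  qed (intro integrable_continuous_real continuous_intros)+
  have 2: "L ^ 3 / (L\<^sup>2 + H\<^sup>2) * I H \<le> L ^ 3 / (L\<^sup>2 + h\<^sup>2) * I h"
  proof (cases "L = 0")
    case False
    then have "0 < L" "h\<^sup>2 \<le> H\<^sup>2" using L assms by (auto intro!: power_mono)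
    then have "L ^ 3 / (L\<^sup>2 + H\<^sup>2) \<le> L ^ 3 / (L\<^sup>2 + h\<^sup>2)"
      by (intro divide_left_mono) (auto intro!: mult_pos_pos add_pos_nonneg)
    then show ?thesis
      by (rule mult_mono) (use \<open>I H \<le> I h\<close> Ipos[of H] L in auto)
  qed simp
  have 1: "exp (- 2 * H) * (1 - cos t) \<le> exp (- 2 * h) * (1 - cos t)"
    using assms by (intro mult_right_mono) auto
  have "exp (- 2 * H) * (1 - cos t) + L ^ 3 / (L\<^sup>2 + H\<^sup>2) * I H
      < exp (- 2 * h) * (1 - cos t) + L ^ 3 / (L\<^sup>2 + h\<^sup>2) * I h"
  \<comment> \<open>Strictness comes from the plateau if t > 0. At t = 0 the plateau term vanishes,
    and strictness comes from the coefficient of the cone, where L = R > 0.\<close>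
  proof (cases "t = 0")
    case True
    then have "L > 0" using assms by (simp add: L_def)
    moreover have "h\<^sup>2 < H\<^sup>2" using assms by (intro power_strict_mono) auto
    ultimately have "L ^ 3 / (L\<^sup>2 + H\<^sup>2) < L ^ 3 / (L\<^sup>2 + h\<^sup>2)"
      by (intro divide_strict_left_mono) (auto intro!: mult_pos_pos add_pos_nonneg)
    then have "L ^ 3 / (L\<^sup>2 + H\<^sup>2) * I H < L ^ 3 / (L\<^sup>2 + h\<^sup>2) * I h"
      using \<open>I H \<le> I h\<close> Ipos[of H] \<open>L > 0\<close> by (intro mult_less_le_imp_less) auto
    then show ?thesis using 1 by linarith
  next
    case False
    then have "cos t < cos 0"
      using assms by (intro cos_monotone_0_pi) auto
    then have "exp (- 2 * H) * (1 - cos t) < exp (- 2 * h) * (1 - cos t)"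
      using assms by (intro mult_strict_right_mono) auto
    then show ?thesis using 2 by linarith
  qed
  then show ?thesis
    using assms by (simp add: R2_rot_u_frustum L_def I_def)
qed

section \<open>The derivative at height H with respect to L = R - t\<close>

definition frustum_profile :: "real \<Rightarrow> real \<Rightarrow> real \<Rightarrow> real" where
  "frustum_profile H R L = exp (- 2 * H) * (1 - cos (R - L))
    + L ^ 3 / (L\<^sup>2 + H\<^sup>2) * sin_moment R (\<lambda>x. exp (- 2 * H * x)) L"

text \<open>The quantity B of the opening comment, in the form in which differentiation produces
  it.\<close>

definition slope_main :: "real \<Rightarrow> real \<Rightarrow> real \<Rightarrow> real" where
  "slope_main H R L =
    H * (2 * sin_moment R (\<lambda>x. exp (- 2 * H * x)) L - exp (- 2 * H) * sin (R - L))
    + 2 * (L\<^sup>2 + H\<^sup>2) * sin_moment R (\<lambda>x. x * exp (- 2 * H * x)) L"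

definition slope_numerator :: "real \<Rightarrow> real \<Rightarrow> real \<Rightarrow> real" where
  "slope_numerator H R L = L\<^sup>2 * slope_main H R L - exp (- 2 * H) * H ^ 3 * sin (R - L)"

text \<open>After differentiation, L D is replaced by I - 2 H J - e s. The terms in L^4 I then
  cancel and a common factor H comes out.\<close>

lemma frustum_profile_has_derivative:
  assumes "H > 0"
  shows "(frustum_profile H R has_field_derivative
    H * slope_numerator H R L / (L\<^sup>2 + H\<^sup>2)\<^sup>2) (at L)"
proof -
  define w where "w = (\<lambda>x. exp (- 2 * H * x))"
  define I J D e s where "I = sin_moment R w L" and "J = sin_moment R (\<lambda>x. x * w x) L"
    and "D = cos_moment R (\<lambda>x. x * w x) L" and "e = exp (- 2 * H)" and "s = sin (R - L)"
  have cw: "continuous_on UNIV w"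
    unfolding w_def by (intro continuous_intros)
  have pos: "L\<^sup>2 + H\<^sup>2 > 0" using assms by (simp add: add_nonneg_pos)
  have parts: "e * s = I - 2 * H * J - L * D"
    unfolding e_def s_def I_def J_def D_def w_def by (rule exp_sin_moment_by_parts)
  have "(frustum_profile H R has_field_derivative - e * s
      + (((3 * L\<^sup>2) * (L\<^sup>2 + H\<^sup>2) - L ^ 3 * (2 * L)) / ((L\<^sup>2 + H\<^sup>2) * (L\<^sup>2 + H\<^sup>2)) * I
        + (- D) * (L ^ 3 / (L\<^sup>2 + H\<^sup>2)))) (at L)"
    unfolding frustum_profile_def[abs_def] w_def[symmetric] I_def D_def e_def s_def
    by (intro DERIV_add DERIV_mult DERIV_divide sin_moment_has_derivative[OF cw])
      (use pos in \<open>auto intro!: derivative_eq_intros\<close>)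
  moreover have "- e * s
      + (((3 * L\<^sup>2) * (L\<^sup>2 + H\<^sup>2) - L ^ 3 * (2 * L)) / ((L\<^sup>2 + H\<^sup>2) * (L\<^sup>2 + H\<^sup>2)) * I
        + (- D) * (L ^ 3 / (L\<^sup>2 + H\<^sup>2))) = H * slope_numerator H R L / (L\<^sup>2 + H\<^sup>2)\<^sup>2"
  proof -
    have N: "slope_numerator H R L =
        L\<^sup>2 * (H * (2 * I - e * s) + 2 * (L\<^sup>2 + H\<^sup>2) * J) - H ^ 3 * (e * s)"
      by (simp add: slope_numerator_def slope_main_def I_def J_def e_def s_def w_def)
    have "(- e * s) * (L\<^sup>2 + H\<^sup>2)\<^sup>2 + ((3 * L\<^sup>2) * (L\<^sup>2 + H\<^sup>2) - L ^ 3 * (2 * L)) * I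
        - D * L ^ 3 * (L\<^sup>2 + H\<^sup>2) = H * slope_numerator H R L"
      unfolding N using parts by algebra
    moreover have "- e * s + (A / (P * P) * I + (- D) * (C / P)) =
        ((- e * s) * P\<^sup>2 + A * I - D * C * P) / P\<^sup>2" if "P > 0" for A C P :: real
      using that by (simp add: field_simps power2_eq_square)
    ultimately show ?thesis using pos by simp
  qed
  ultimately show ?thesis by simp
qed

lemma continuous_on_slope_numerator:
  "continuous_on S (slope_numerator H R)"
  unfolding slope_numerator_def[abs_def] slope_main_def by (intro continuous_intros)

text \<open>The definition of \<^const>\<open>slope_main\<close> contains a negative term; integrating by parts
  once more trades it for an integrand that is visibly nonnegative and monotone in \<open>L\<close>.\<close>
lemma slope_main_eq:
  "slope_main H R L =
    H * integral {0..1} (\<lambda>x. exp (- 2 * H * x) * (sin (R - L * x) + L * x * cos (R - L * x)))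
    + 2 * (L\<^sup>2 + 2 * H\<^sup>2) * sin_moment R (\<lambda>x. x * exp (- 2 * H * x)) L"
proof -
  define I J D T e where "I = sin_moment R (\<lambda>x. exp (- 2 * H * x)) L"
    and "J = sin_moment R (\<lambda>x. x * exp (- 2 * H * x)) L"
    and "D = cos_moment R (\<lambda>x. x * exp (- 2 * H * x)) L"
    and "T = integral {0..1} (\<lambda>x. exp (- 2 * H * x) * (sin (R - L * x) + L * x * cos (R - L * x)))"
    and "e = exp (- 2 * H) * sin (R - L)"
  have "((\<lambda>x. exp (- 2 * H * x) * sin (R - L * x) + L * (x * exp (- 2 * H * x) * cos (R - L * x)))
      has_integral I + L * D) {0..1}"
    unfolding sin_moment_def cos_moment_def I_def D_def
    by (intro has_integral_add has_integral_mult_right integrable_integral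
        integrable_continuous_real continuous_intros)
  then have "T = I + L * D"
    unfolding T_def by (intro integral_unique) (simp add: algebra_simps)
  moreover have "e = I - 2 * H * J - L * D"
    unfolding e_def I_def J_def D_def by (rule exp_sin_moment_by_parts)
  ultimately have "H * (2 * I - e) + 2 * (L\<^sup>2 + H\<^sup>2) * J = H * T + 2 * (L\<^sup>2 + 2 * H\<^sup>2) * J"
    by algebra
  then show ?thesis
    by (simp only: slope_main_def I_def J_def T_def e_def)
qed

section \<open>Single sign change of the slope and the unique minimum in L\<close>

context
  fixes H R :: real
  assumes H: "H > 0" and R: "0 < R" "R < pi"
begin

lemma slope_main_pos:
  assumes "0 \<le> L" "L \<le> R"
  shows "slope_main H R L > 0"
proof -
  have "integral {0..1} (\<lambda>x. exp (- 2 * H * x) * (sin (R - L * x) + L * x * cos (R - L * x))) \<ge> 0"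
  proof (rule integral_nonneg)
    fix x :: real assume x: "x \<in> {0..1}"
    then have "L * x \<le> L" "0 \<le> L * x"
      using assms by (simp_all add: mult_left_le)
    then have "0 \<le> sin (R - L * x) + L * x * cos (R - L * x)"
      by (intro sin_tangent_nonneg; use assms R in linarith)
    then show "0 \<le> exp (- 2 * H * x) * (sin (R - L * x) + L * x * cos (R - L * x))"
      by simp
  qed (intro integrable_continuous_real continuous_intros)
  moreover have "sin_moment R (\<lambda>x. x * exp (- 2 * H * x)) L > 0"
    by (intro sin_moment_pos continuous_intros) (use assms R in auto)
  moreover have "L\<^sup>2 + 2 * H\<^sup>2 > 0" using H by (simp add: add_nonneg_pos)
  ultimately show ?thesis
    unfolding slope_main_eq using H by (intro add_nonneg_pos mult_nonneg_nonneg mult_pos_pos) auto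
qed

text \<open>Cross-multiplied monotonicity of L B / sin (R - L), proved under each integral. In T the
  tangent expression itself grows with L, so \<open>sin_over_arg_antimono\<close> suffices for the
  remaining factor. In J the sine need not grow with L, so \<open>sin_ratio_mono\<close> is used;
  the coefficient L^2 + 2 H^2 grows as well.\<close>

lemma slope_main_ratio_mono:
  assumes "0 < a" "a \<le> b" "b \<le> R"
  shows "a * slope_main H R a * sin (R - b) \<le> b * slope_main H R b * sin (R - a)"
proof -
  define T where "T = (\<lambda>L. integral {0..1}
    (\<lambda>x. exp (- 2 * H * x) * (sin (R - L * x) + L * x * cos (R - L * x))))"
  define J where "J = sin_moment R (\<lambda>x. x * exp (- 2 * H * x))"
  have sin: "sin (R - b) \<ge> 0" "sin (R - a) \<ge> 0"
    by (rule sin_ge_zero; use assms R in linarith)+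
  have "integral {0..1} (\<lambda>x. a * sin (R - b) * (exp (- 2 * H * x) * (sin (R - a * x) + a * x * cos (R - a * x))))
      \<le> integral {0..1} (\<lambda>x. b * sin (R - a) * (exp (- 2 * H * x) * (sin (R - b * x) + b * x * cos (R - b * x))))"
  proof (rule integral_le)
    fix x :: real assume x: "x \<in> {0..1}"
    have ax: "0 \<le> a * x" "a * x \<le> b * x" "b * x \<le> b"
      using x assms by (simp_all add: mult_left_le mult_right_mono)
    have "a * sin (R - b) * (sin (R - a * x) + a * x * cos (R - a * x))
        \<le> b * sin (R - a) * (sin (R - b * x) + b * x * cos (R - b * x))"
    proof (rule mult_mono)
      show "a * sin (R - b) \<le> b * sin (R - a)"
        using assms R by (intro sin_over_arg_antimono) auto
      show "sin (R - a * x) + a * x * cos (R - a * x) \<le> sin (R - b * x) + b * x * cos (R - b * x)"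
        by (rule sin_tangent_mono; use ax assms R in linarith)
      show "0 \<le> sin (R - a * x) + a * x * cos (R - a * x)"
        by (rule sin_tangent_nonneg; use ax assms R in linarith)
      show "0 \<le> b * sin (R - a)" using sin assms by simp
    qed
    then have "exp (- 2 * H * x) * (a * sin (R - b) * (sin (R - a * x) + a * x * cos (R - a * x)))
        \<le> exp (- 2 * H * x) * (b * sin (R - a) * (sin (R - b * x) + b * x * cos (R - b * x)))"
      by (intro mult_left_mono) auto
    then show "a * sin (R - b) * (exp (- 2 * H * x) * (sin (R - a * x) + a * x * cos (R - a * x)))
      \<le> b * sin (R - a) * (exp (- 2 * H * x) * (sin (R - b * x) + b * x * cos (R - b * x)))"
      by (simp only: mult_ac)
  qed (intro integrable_continuous_real continuous_intros)+
  then have T: "a * sin (R - b) * T a \<le> b * sin (R - a) * T b"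
    by (simp add: T_def)
  have "integral {0..1} (\<lambda>x. a * sin (R - b) * (x * exp (- 2 * H * x) * sin (R - a * x)))
      \<le> integral {0..1} (\<lambda>x. b * sin (R - a) * (x * exp (- 2 * H * x) * sin (R - b * x)))"
  proof (rule integral_le)
    fix x :: real assume x: "x \<in> {0..1}"
    have "x * exp (- 2 * H * x) * (a * sin (R - a * x) * sin (R - b))
        \<le> x * exp (- 2 * H * x) * (b * sin (R - b * x) * sin (R - a))"
      using x assms R by (intro mult_left_mono sin_ratio_mono) auto
    then show "a * sin (R - b) * (x * exp (- 2 * H * x) * sin (R - a * x))
      \<le> b * sin (R - a) * (x * exp (- 2 * H * x) * sin (R - b * x))"
      by (simp only: mult_ac)
  qed (intro integrable_continuous_real continuous_intros)+
  then have J: "a * sin (R - b) * J a \<le> b * sin (R - a) * J b"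
    by (simp add: J_def sin_moment_def)
  have "J a > 0"
    unfolding J_def by (intro sin_moment_pos continuous_intros) (use assms R in auto)
  have "2 * (a\<^sup>2 + 2 * H\<^sup>2) * (a * sin (R - b) * J a) \<le> 2 * (b\<^sup>2 + 2 * H\<^sup>2) * (b * sin (R - a) * J b)"
  proof (rule mult_mono[OF _ J])
    show "2 * (a\<^sup>2 + 2 * H\<^sup>2) \<le> 2 * (b\<^sup>2 + 2 * H\<^sup>2)"
      using assms by (simp add: power_mono)
    show "0 \<le> a * sin (R - b) * J a"
      using assms sin \<open>J a > 0\<close> by simp
  qed (simp add: add_nonneg_nonneg)
  moreover have "H * (a * sin (R - b) * T a) \<le> H * (b * sin (R - a) * T b)"
    using T H by (intro mult_left_mono) auto
  moreover have "slope_main H R L = H * T L + 2 * (L\<^sup>2 + 2 * H\<^sup>2) * J L" for L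
    unfolding T_def J_def by (rule slope_main_eq)
  ultimately show ?thesis
    by (simp add: algebra_simps)
qed

text \<open>Below R, the sign of the numerator compares L^2 B / sin (R - L) with the constant
  \<open>exp (- 2 * H) * H ^ 3\<close>. One more factor L on top of
  \<open>slope_main_ratio_mono\<close>, together with B > 0, makes that ratio strictly
  increasing.\<close>

lemma slope_numerator_single_crossing:
  assumes "0 < a" "a < b" "b < R" "slope_numerator H R a \<ge> 0"
  shows "slope_numerator H R b > 0"
proof -
  have s: "sin (R - a) > 0" "sin (R - b) > 0"
    by (rule sin_gt_zero; use assms R in linarith)+
  have "a * (a * slope_main H R a * sin (R - b)) < b * (a * slope_main H R a * sin (R - b))"
    using assms s slope_main_pos[of a] by (intro mult_strict_right_mono mult_pos_pos) auto
  also have "\<dots> \<le> b * (b * slope_main H R b * sin (R - a))"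
    using assms by (intro mult_left_mono slope_main_ratio_mono) auto
  finally have 1: "a\<^sup>2 * slope_main H R a * sin (R - b) < b\<^sup>2 * slope_main H R b * sin (R - a)"
    by (simp add: power2_eq_square mult_ac)
  have "exp (- 2 * H) * H ^ 3 * sin (R - a) * sin (R - b) \<le> a\<^sup>2 * slope_main H R a * sin (R - b)"
    using assms(4) s by (intro mult_right_mono) (auto simp: slope_numerator_def)
  with 1 have "exp (- 2 * H) * H ^ 3 * sin (R - b) * sin (R - a) < b\<^sup>2 * slope_main H R b * sin (R - a)"
    by (simp add: mult_ac)
  then show ?thesis
    using s by (simp add: slope_numerator_def)
qed

text \<open>Covers the endpoint excluded from the crossing lemma: sin (R - L) vanishes there and
  only R^2 B remains.\<close>

lemma slope_numerator_at_R: "slope_numerator H R R > 0"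
  using slope_main_pos[of R] R by (simp add: slope_numerator_def)

lemma slope_numerator_sign:
  obtains Ls where "0 < Ls" "Ls < R"
    "\<And>L. 0 < L \<Longrightarrow> L < Ls \<Longrightarrow> slope_numerator H R L < 0"
    "slope_numerator H R Ls = 0"
    "\<And>L. Ls < L \<Longrightarrow> L \<le> R \<Longrightarrow> slope_numerator H R L > 0"
proof -
  have N0: "slope_numerator H R 0 < 0"
    using H R by (simp add: slope_numerator_def sin_gt_zero)
  have "\<exists>L\<ge>0. L \<le> R \<and> slope_numerator H R L = 0"
    using N0 slope_numerator_at_R R by (intro IVT' continuous_on_slope_numerator) auto
  then obtain Ls where Ls: "0 \<le> Ls" "Ls \<le> R" "slope_numerator H R Ls = 0"
    by blast
  then have Ls': "0 < Ls" "Ls < R"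
    using N0 slope_numerator_at_R by (auto simp: less_le)
  show ?thesis
  proof (rule that[OF Ls' _ Ls(3)])
    \<comment> \<open>A nonnegative value to the left of \<open>Ls\<close> would force a positive
      value at the zero \<open>Ls\<close>.\<close>
    show "slope_numerator H R L < 0" if "0 < L" "L < Ls" for L
      using slope_numerator_single_crossing[of L Ls] that Ls Ls' by fastforce
    show "slope_numerator H R L > 0" if "Ls < L" "L \<le> R" for L
      using slope_numerator_single_crossing[of Ls L] slope_numerator_at_R that Ls Ls'
      by (cases "L = R") auto
  qed
qed

text \<open>The sign change makes the profile strictly decreasing on [0, Ls] and strictly increasing
  on [Ls, R], endpoints included by continuity.\<close>

lemma frustum_profile_unique_min:
  obtains Ls where "0 < Ls" "Ls < R"
    "\<And>L. 0 < L \<Longrightarrow> L < R \<Longrightarrow> slope_numerator H R L = 0 \<longleftrightarrow> L = Ls"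
    "\<And>L. 0 \<le> L \<Longrightarrow> L \<le> R \<Longrightarrow> L \<noteq> Ls \<Longrightarrow> frustum_profile H R Ls < frustum_profile H R L"
proof -
  obtain Ls where Ls: "0 < Ls" "Ls < R"
    and neg: "\<And>L. 0 < L \<Longrightarrow> L < Ls \<Longrightarrow> slope_numerator H R L < 0"
    and zero: "slope_numerator H R Ls = 0"
    and pos: "\<And>L. Ls < L \<Longrightarrow> L \<le> R \<Longrightarrow> slope_numerator H R L > 0"
    using slope_numerator_sign by blast
  note D = frustum_profile_has_derivative[OF H, of R]
  have den: "(L\<^sup>2 + H\<^sup>2)\<^sup>2 > 0" for L
    using H by (simp add: add_nonneg_pos zero_less_power)
  have cont: "continuous_on S (frustum_profile H R)" for S
    by (meson D DERIV_isCont continuous_at_imp_continuous_on)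
  show ?thesis
  proof (rule that[OF Ls])
    show "slope_numerator H R L = 0 \<longleftrightarrow> L = Ls" if "0 < L" "L < R" for L
      using neg[of L] pos[of L] zero that by (cases L Ls rule: linorder_cases) auto
    show "frustum_profile H R Ls < frustum_profile H R L" if L: "0 \<le> L" "L \<le> R" "L \<noteq> Ls" for L
    proof (cases "L < Ls")
      case True
      then show ?thesis
      proof (rule DERIV_neg_imp_decreasing_open[OF _ _ cont])
        fix x assume "L < x" "x < Ls"
        then have "H * slope_numerator H R x / (x\<^sup>2 + H\<^sup>2)\<^sup>2 < 0"
          using neg[of x] H L den by (intro divide_neg_pos mult_pos_neg) auto
        then show "\<exists>y. (frustum_profile H R has_field_derivative y) (at x) \<and> y < 0"
          using D by blast
      qed
    next
      case False
      then have "Ls < L" using L by simp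
      then show ?thesis
      proof (rule DERIV_pos_imp_increasing_open[OF _ _ cont])
        fix x assume "Ls < x" "x < L"
        then have "H * slope_numerator H R x / (x\<^sup>2 + H\<^sup>2)\<^sup>2 > 0"
          using pos[of x] H L den by (intro divide_pos_pos mult_pos_pos) auto
        then show "\<exists>y. (frustum_profile H R has_field_derivative y) (at x) \<and> y > 0"
          using D by blast
      qed
    qed
  qed
qed

end

section \<open>Return to the variables h and t, with the minimizer at t = R - Ls\<close>

theorem mainTheorem10:
  fixes H R :: real
  assumes "H > 0" and "0 < R" and "R < pi"
  defines "g \<equiv> (\<lambda>\<theta>0. R2_rot R (u_frustum R H \<theta>0))"
  shows "(\<forall>t\<in>{0<..<R}. g differentiable (at t)) \<and>
    (\<exists>\<theta>s. \<theta>s \<in> {0<..<R} \<and> deriv g \<theta>s = 0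
       \<and> (\<forall>t\<in>{0<..<R}. deriv g t = 0 \<longrightarrow> t = \<theta>s)
       \<and> (\<forall>h\<in>{0..H}. \<forall>t\<in>{0..R}.
            R2_rot R (u_frustum R H \<theta>s) \<le> R2_rot R (u_frustum R h t))
       \<and> (\<forall>h\<in>{0..H}. \<forall>t\<in>{0..R}.
            R2_rot R (u_frustum R h t) = R2_rot R (u_frustum R H \<theta>s) \<longrightarrow> h = H \<and> t = \<theta>s))"
proof -
  define N where "N = slope_numerator H R"
  define f where "f = frustum_profile H R"
  have g_eq: "R2_rot R (u_frustum R H t) = 2 * pi * f (R - t)" if "0 \<le> t" "t \<le> R" for t
    using R2_rot_u_frustum[OF that, of H] by (simp add: f_def frustum_profile_def)
  obtain Ls where Ls: "0 < Ls" "Ls < R"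
    and crit: "\<And>L. 0 < L \<Longrightarrow> L < R \<Longrightarrow> N L = 0 \<longleftrightarrow> L = Ls"
    and min: "\<And>L. 0 \<le> L \<Longrightarrow> L \<le> R \<Longrightarrow> L \<noteq> Ls \<Longrightarrow> f Ls < f L"
    using frustum_profile_unique_min[OF assms(1-3)] unfolding N_def f_def by metis
  \<comment> \<open>The closed form of g is available only for t in [0, R], hence the transfer from
    an open subinterval. The minus sign comes from L = R - t.\<close>
  have deriv_g: "(g has_field_derivative - (2 * pi * (H * N (R - t) / ((R - t)\<^sup>2 + H\<^sup>2)\<^sup>2))) (at t)"
    if "t \<in> {0<..<R}" for t
  proof (rule has_field_derivative_transform_within_open[where S = "{0<..<R}"])
    show "((\<lambda>t. 2 * pi * f (R - t)) has_field_derivative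
        - (2 * pi * (H * N (R - t) / ((R - t)\<^sup>2 + H\<^sup>2)\<^sup>2))) (at t)"
      unfolding f_def N_def
      by (rule derivative_eq_intros DERIV_chain2[OF frustum_profile_has_derivative] refl assms(1))+ simp
  qed (use that in \<open>auto simp: g_def g_eq\<close>)
  have deriv_zero: "deriv g t = 0 \<longleftrightarrow> t = R - Ls" if t: "t \<in> {0<..<R}" for t
  proof -
    have "(R - t)\<^sup>2 + H\<^sup>2 > 0" using assms(1) by (simp add: add_nonneg_pos)
    then have "deriv g t = 0 \<longleftrightarrow> N (R - t) = 0"
      using assms(1) by (simp add: DERIV_imp_deriv[OF deriv_g[OF t]])
    then show ?thesis using crit[of "R - t"] t by auto
  qed
  \<comment> \<open>Raising h to H at fixed t and then moving t to R - Ls never increases the value,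
    and at least one of the two moves is strict. Minimality and uniqueness both follow.\<close>
  have strict: "R2_rot R (u_frustum R H (R - Ls)) < R2_rot R (u_frustum R h t)"
    if "h \<in> {0..H}" "t \<in> {0..R}" "\<not> (h = H \<and> t = R - Ls)" for h t
  proof -
    have le: "R2_rot R (u_frustum R H (R - Ls)) \<le> R2_rot R (u_frustum R H t)"
      and less: "t \<noteq> R - Ls \<Longrightarrow> R2_rot R (u_frustum R H (R - Ls)) < R2_rot R (u_frustum R H t)"
      using min[of "R - t"] that Ls by (cases "t = R - Ls"; auto simp: g_eq)+
    show ?thesis
    proof (cases "h = H")
      case True
      then show ?thesis using less that by auto
    next
      case False
      then have "R2_rot R (u_frustum R H t) < R2_rot R (u_frustum R h t)"
        using that assms by (intro R2_rot_u_frustum_strict_antimono) auto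
      with le show ?thesis by simp
    qed
  qed
  show ?thesis
  proof (intro conjI exI[of _ "R - Ls"] ballI)
    show "g differentiable (at t)" if "t \<in> {0<..<R}" for t
      using deriv_g[OF that] real_differentiable_def by blast
    show "R - Ls \<in> {0<..<R}" "deriv g (R - Ls) = 0"
      using Ls deriv_zero[of "R - Ls"] by auto
    show "deriv g t = 0 \<longrightarrow> t = R - Ls" if "t \<in> {0<..<R}" for t
      using deriv_zero[OF that] by simp
    show "R2_rot R (u_frustum R H (R - Ls)) \<le> R2_rot R (u_frustum R h t)"
      if "h \<in> {0..H}" "t \<in> {0..R}" for h t
      using strict[OF that] by (cases "h = H \<and> t = R - Ls") auto
    show "R2_rot R (u_frustum R h t) = R2_rot R (u_frustum R H (R - Ls)) \<longrightarrow> h = H \<and> t = R - Ls"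
      if "h \<in> {0..H}" "t \<in> {0..R}" for h t
      using strict[OF that] by (metis less_irrefl)
  qed
qed

end
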